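(* Let $(X,d)$ be a normal, regular, and complete semi-metric space. Let $q\ge 1$, $V=\{1,\dots,q\}$, and for $i,j\in V$ let $E_{i,j}$ be a finite set of directed edges from $i$ to $j$ such that for every $i\in V$ there exists $j\in V$ with $E_{i,j}\neq\emptyset$. For each $i,j\in V$ and each $e\in E_{i,j}$ let $\phi_e$ be a right-continuous comparison function and $f_e:X\to X$ a $\phi_e$-contraction. Define, for $\mathbf{H}=(H_1,\dots,H_q)\in\mathcal{P}(X)^q$, $$T(\mathbf{H})=\left(\bigcup_{j=1}^{q}\bigcup_{e\in E_{i,j}} f_e(H_j)\right)_{i=1}^{q}.$$ Then there exists an element $\mathbf{H}_0\in\mathcal{F}(X)^q$ such that $\mathbf{H}_0\neq\emptyset$ and $\mathbf{H}_0\subset T(\mathbf{H}_0)$.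
   Context: Let $X$ be a non-empty set. A map $d:X^2\to[0,\infty)$ is a semi-metric if $d(x,y)=0$ if and only if $x=y$, and $d(x,y)=d(y,x)$ for all $x,y$. Put $B(x,r)=\{y\in X: d(x,y)<r\}$. A sequence $(x_n)_n$ is convergent if $\lim_n d(x_n,x)=0$ for some $x\in X$, and Cauchy if $\lim_{n,m\to\infty}d(x_n,x_m)=0$; $(X,d)$ is complete if every Cauchy sequence is convergent. The basic triangle function of $d$ is $\Phi_d(u,v)=\sup\{d(x,y): x,y\in X,\ \exists z\in X \text{ with } d(x,z)\le u,\ d(y,z)\le v\}\in[0,\infty]$ for $u,v\in[0,\infty)$. $(X,d)$ is regular if $\Phi_d$ is continuous at $(0,0)$, and normal if $\Phi_d(u,v)\neq\infty$ for all $u,v\in[0,\infty)$. A comparison function is a map $\phi:[0,\infty)\to[0,\infty)$ that is increasing (in the weak sense) with $\lim_{n\to\infty}\phi^n(t)=0$ for every $t>0$ ($\phi^n$ is the $n$-fold iterate). $f:X\to X$ is a $\phi$-contraction if $d(f(x),f(y))\le\phi(d(x,y))$ for all $x,y\in X$. $\mathcal{P}(X)$ is the set of non-empty subsets of $X$. A subset $H\subset X$ is bounded if $H\subset B(x_0,r_0)$ for some $x_0\in X$, $r_0>0$; $\mathcal{F}(X)$ is the set of non-empty bounded subsets of $X$. For $\mathbf{A},\mathbf{B}\in\mathcal{P}(X)^q$, $\mathbf{A}\subset\mathbf{B}$ means $A_i\subset B_i$ for all $i$. "$\mathbf{H}_0\neq\emptyset$" means its components are non-empty (automatic for elements of $\mathcal{F}(X)^q$).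 *)

theory Defs
  imports "HOL-Analysis.Analysis"
begin

definition semimetric :: "'a set \<Rightarrow> ('a \<Rightarrow> 'a \<Rightarrow> real) \<Rightarrow> bool" where
  "semimetric X d \<longleftrightarrow> X \<noteq> {} \<and>
     (\<forall>x\<in>X. \<forall>y\<in>X. 0 \<le> d x y \<and> (d x y = 0 \<longleftrightarrow> x = y) \<and> d x y = d y x)"

definition sm_ball :: "'a set \<Rightarrow> ('a \<Rightarrow> 'a \<Rightarrow> real) \<Rightarrow> 'a \<Rightarrow> real \<Rightarrow> 'a set" where
  "sm_ball X d x r = {y \<in> X. d x y < r}"

definition sm_convergent :: "'a set \<Rightarrow> ('a \<Rightarrow> 'a \<Rightarrow> real) \<Rightarrow> (nat \<Rightarrow> 'a) \<Rightarrow> bool" where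
  "sm_convergent X d \<sigma> \<longleftrightarrow> (\<exists>x\<in>X. (\<lambda>n. d (\<sigma> n) x) \<longlonglongrightarrow> 0)"

definition sm_Cauchy :: "('a \<Rightarrow> 'a \<Rightarrow> real) \<Rightarrow> (nat \<Rightarrow> 'a) \<Rightarrow> bool" where
  "sm_Cauchy d \<sigma> \<longleftrightarrow>
     ((\<lambda>(n, m). d (\<sigma> n) (\<sigma> m)) \<longlongrightarrow> 0) (sequentially \<times>\<^sub>F sequentially)"

definition sm_complete :: "'a set \<Rightarrow> ('a \<Rightarrow> 'a \<Rightarrow> real) \<Rightarrow> bool" where
  "sm_complete X d \<longleftrightarrow>
     (\<forall>\<sigma>. range \<sigma> \<subseteq> X \<and> sm_Cauchy d \<sigma> \<longrightarrow> sm_convergent X d \<sigma>)"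

(* Only meaningful for u, v \<ge> 0. The coercion ennreal truncates negative reals to 0,
   which does not matter here because d is nonnegative on X. *)
definition basic_triangle :: "'a set \<Rightarrow> ('a \<Rightarrow> 'a \<Rightarrow> real) \<Rightarrow> real \<Rightarrow> real \<Rightarrow> ennreal" where
  "basic_triangle X d u v =
     Sup {ennreal (d x y) | x y. x \<in> X \<and> y \<in> X \<and> (\<exists>z\<in>X. d x z \<le> u \<and> d y z \<le> v)}"

definition sm_regular :: "'a set \<Rightarrow> ('a \<Rightarrow> 'a \<Rightarrow> real) \<Rightarrow> bool" where
  "sm_regular X d \<longleftrightarrow>
     continuous (at (0, 0) within {0..} \<times> {0..}) (\<lambda>(u, v). basic_triangle X d u v)"

definition sm_normal :: "'a set \<Rightarrow> ('a \<Rightarrow> 'a \<Rightarrow> real) \<Rightarrow> bool" where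
  "sm_normal X d \<longleftrightarrow> (\<forall>u\<ge>0. \<forall>v\<ge>0. basic_triangle X d u v \<noteq> \<infinity>)"

(* Maps on [0,\<infinity>) are functions on the reals whose values at negative arguments are irrelevant. *)
definition comparison_function :: "(real \<Rightarrow> real) \<Rightarrow> bool" where
  "comparison_function \<phi> \<longleftrightarrow> \<phi> \<in> {0..} \<rightarrow> {0..} \<and> mono_on {0..} \<phi> \<and>
     (\<forall>t>0. (\<lambda>n. (\<phi> ^^ n) t) \<longlonglongrightarrow> 0)"

definition right_continuous :: "(real \<Rightarrow> real) \<Rightarrow> bool" where
  "right_continuous \<phi> \<longleftrightarrow> (\<forall>t\<ge>0. continuous (at_right t) \<phi>)"

definition phi_contraction ::
  "'a set \<Rightarrow> ('a \<Rightarrow> 'a \<Rightarrow> real) \<Rightarrow> (real \<Rightarrow> real) \<Rightarrow> ('a \<Rightarrow> 'a) \<Rightarrow> bool" where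
  "phi_contraction X d \<phi> f \<longleftrightarrow> f \<in> X \<rightarrow> X \<and>
     (\<forall>x\<in>X. \<forall>y\<in>X. d (f x) (f y) \<le> \<phi> (d x y))"

definition sm_bounded :: "'a set \<Rightarrow> ('a \<Rightarrow> 'a \<Rightarrow> real) \<Rightarrow> 'a set \<Rightarrow> bool" where
  "sm_bounded X d H \<longleftrightarrow> (\<exists>x0\<in>X. \<exists>r0>0. H \<subseteq> sm_ball X d x0 r0)"

definition nonempty_bounded_subsets :: "'a set \<Rightarrow> ('a \<Rightarrow> 'a \<Rightarrow> real) \<Rightarrow> 'a set set" where
  "nonempty_bounded_subsets X d = {H. H \<subseteq> X \<and> H \<noteq> {} \<and> sm_bounded X d H}"

(* A q-tuple is an extensional function on {1..q}, i.e. an element of some PiE {1..q} _.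
   E i j is the set of edges from i to j. *)
definition graph_operator ::
  "nat \<Rightarrow> (nat \<Rightarrow> nat \<Rightarrow> 'e set) \<Rightarrow> ('e \<Rightarrow> 'a \<Rightarrow> 'a) \<Rightarrow> (nat \<Rightarrow> 'a set) \<Rightarrow> (nat \<Rightarrow> 'a set)" where
  "graph_operator q E f H = (\<lambda>i\<in>{1..q}. \<Union>j\<in>{1..q}. \<Union>e\<in>E i j. f e ` H j)"

end

theory Submission
  imports Defs
begin

text \<open>
  The required tuple can be chosen to consist of singletons. Pick for every vertex \<open>i\<close> one edge
  \<open>e i\<close> starting at \<open>i\<close>, with end point \<open>s i\<close>. A family of points with
  \<open>x i = f (e i) (x (s i))\<close> for all \<open>i\<close> yields \<open>H0 i = {x i}\<close>, and such a family is the same thing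
  as a fixed point of the map \<open>F x i = f (e i) (x (s i))\<close> on the power \<open>X\<^sup>q\<close>.

  With the maximum distance, \<open>X\<^sup>q\<close> is again a regular and complete semi-metric space, and \<open>F\<close> is a
  contraction with respect to the pointwise maximum of the finitely many functions
  \<open>\<phi> (e i)\<close>. This maximum is a comparison function (\<open>comparison_function_Max\<close>). This is
  where right-continuity enters: a comparison function satisfies \<open>\<phi> t < t\<close> for \<open>t > 0\<close>, a property
  that passes to finite maxima, and an increasing right-continuous function with this
  property is a comparison function, because the limit \<open>l\<close> of its iterates cannot be positive.

  The fixed point comes from the contraction principle in regular complete semi-metric spaces
  (\<open>regular_complete_fixed_point\<close>). Regularity replaces the triangle inequality in the proof that
  the Picard iterates form a Cauchy sequence: some power of the map leaves small closed balls
  around late iterates invariant.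
\<close>

section \<open>Epsilon-delta forms of regularity and of the Cauchy property\<close>

lemma semimetricD:
  assumes "semimetric X d" "x \<in> X" "y \<in> X"
  shows "0 \<le> d x y" "d x y = 0 \<longleftrightarrow> x = y" "d x y = d y x"
  using assms unfolding semimetric_def by blast+

lemma semimetric_self [simp]:
  assumes "semimetric X d" "x \<in> X"
  shows "d x x = 0"
  using semimetricD(2)[OF assms(1) assms(2) assms(2)] by simp

lemma basic_triangle_0_0:
  assumes "semimetric X d"
  shows "basic_triangle X d 0 0 = 0"
proof -
  have zero: "d x y = 0" if "x \<in> X" "y \<in> X" "z \<in> X" "d x z \<le> 0" "d y z \<le> 0" for x y z
  proof -
    have "d x z = 0" "d y z = 0"
      using semimetricD(1)[OF assms] that by (meson order_antisym)+
    then have "x = z" "y = z"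
      using semimetricD(2)[OF assms] that by blast+
    then show ?thesis
      using assms that by simp
  qed
  have "basic_triangle X d 0 0 \<le> 0"
    unfolding basic_triangle_def
  proof (rule Sup_least, clarify)
    fix x y z assume "x \<in> X" "y \<in> X" "z \<in> X" "d x z \<le> 0" "d y z \<le> 0"
    then show "ennreal (d x y) \<le> 0"
      using zero[of x y z] by simp
  qed
  then show ?thesis
    by simp
qed

text \<open>A single \<open>\<delta>\<close> bounding both distances suffices, as the basic triangle function is
  increasing in both arguments and vanishes at the origin.\<close>

lemma sm_regular_iff:
  assumes "semimetric X d"
  shows "sm_regular X d \<longleftrightarrow>
    (\<forall>\<epsilon>>0. \<exists>\<delta>>0. \<forall>x\<in>X. \<forall>y\<in>X. \<forall>z\<in>X. d x z \<le> \<delta> \<longrightarrow> d y z \<le> \<delta> \<longrightarrow> d x y \<le> \<epsilon>)"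
    (is "_ \<longleftrightarrow> ?R")
proof -
  let ?B = "\<lambda>(u, v). basic_triangle X d u v"
  let ?F = "at (0 :: real, 0 :: real) within {0..} \<times> {0..}"
  have reg: "sm_regular X d \<longleftrightarrow> (?B \<longlongrightarrow> 0) ?F"
    unfolding sm_regular_def continuous_within using basic_triangle_0_0[OF assms] by simp
  show ?thesis
  proof
    assume "sm_regular X d"
    show ?R
    proof (intro allI impI)
      fix \<epsilon> :: real assume "\<epsilon> > 0"
      then have "eventually (\<lambda>p. ?B p < ennreal \<epsilon>) ?F"
        using \<open>sm_regular X d\<close>[unfolded reg] by (intro order_tendstoD(2)) auto
      then obtain \<eta> where \<eta>: "\<eta> > 0" and
        small: "\<And>p. p \<in> {0..} \<times> {0..} \<Longrightarrow> p \<noteq> (0, 0) \<Longrightarrow> dist p (0, 0) < \<eta> \<Longrightarrow> ?B p < ennreal \<epsilon>"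
        unfolding eventually_at by blast
      have "dist (\<eta> / 3, \<eta> / 3) (0 :: real, 0 :: real) \<le> \<eta> / 3 + \<eta> / 3"
        using \<eta> sqrt_sum_squares_le_sum_abs[of "\<eta> / 3" "\<eta> / 3"] by (simp add: dist_Pair_Pair)
      also have "\<dots> < \<eta>"
        using \<eta> by simp
      finally have B: "basic_triangle X d (\<eta> / 3) (\<eta> / 3) < ennreal \<epsilon>"
        using small[of "(\<eta> / 3, \<eta> / 3)"] \<eta> by auto
      have "d x y \<le> \<epsilon>" if "x \<in> X" "y \<in> X" "z \<in> X" "d x z \<le> \<eta> / 3" "d y z \<le> \<eta> / 3" for x y z
      proof -
        have "ennreal (d x y) \<le> basic_triangle X d (\<eta> / 3) (\<eta> / 3)"
          unfolding basic_triangle_def using that by (intro Sup_upper) auto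
        then have "ennreal (d x y) < ennreal \<epsilon>"
          using B by (rule le_less_trans)
        then show ?thesis
          using \<open>\<epsilon> > 0\<close> by (simp add: ennreal_less_iff semimetricD(1)[OF assms that(1,2)])
      qed
      then show "\<exists>\<delta>>0. \<forall>x\<in>X. \<forall>y\<in>X. \<forall>z\<in>X. d x z \<le> \<delta> \<longrightarrow> d y z \<le> \<delta> \<longrightarrow> d x y \<le> \<epsilon>"
        using \<eta> by (intro exI[of _ "\<eta> / 3"]) auto
    qed
  next
    assume R: ?R
    have "(?B \<longlongrightarrow> 0) ?F"
    proof (rule order_tendstoI)
      fix a :: ennreal assume "0 < a"
      then obtain b where b: "0 < b" "b < a"
        using dense by blast
      then obtain \<epsilon> where \<epsilon>: "b = ennreal \<epsilon>" "\<epsilon> > 0"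
        by (cases b) auto
      then obtain \<delta> where \<delta>: "\<delta> > 0" and
        tri: "\<And>x y z. x \<in> X \<Longrightarrow> y \<in> X \<Longrightarrow> z \<in> X \<Longrightarrow> d x z \<le> \<delta> \<Longrightarrow> d y z \<le> \<delta> \<Longrightarrow> d x y \<le> \<epsilon>"
        using R[rule_format, OF \<epsilon>(2)] by auto
      have "basic_triangle X d u v \<le> ennreal \<epsilon>" if "dist (u, v) (0, 0) < \<delta>" for u v
      proof -
        have "u \<le> \<delta>" "v \<le> \<delta>"
          using that dist_fst_le[of "(u, v)" "(0, 0)"] dist_snd_le[of "(u, v)" "(0, 0)"]
          by (auto simp: dist_real_def)
        then show ?thesis
          unfolding basic_triangle_def by (intro Sup_least) (force intro!: ennreal_leI intro: tri)
      qed
      then have "?B p < a" if "dist p (0, 0) < \<delta>" for p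
        using that b \<epsilon> by (cases p) (auto intro: le_less_trans)
      then show "eventually (\<lambda>p. ?B p < a) ?F"
        unfolding eventually_at using \<delta> by blast
    qed simp
    then show "sm_regular X d"
      using reg by simp
  qed
qed

lemma sm_regularE:
  assumes "semimetric X d" "sm_regular X d" "\<epsilon> > 0"
  obtains \<delta> where "\<delta> > 0"
    "\<And>x y z. x \<in> X \<Longrightarrow> y \<in> X \<Longrightarrow> z \<in> X \<Longrightarrow> d x z \<le> \<delta> \<Longrightarrow> d y z \<le> \<delta> \<Longrightarrow> d x y \<le> \<epsilon>"
  using assms(2,3) unfolding sm_regular_iff[OF assms(1)] by meson

lemma sm_Cauchy_iff:
  assumes "semimetric X d" "range \<sigma> \<subseteq> X"
  shows "sm_Cauchy d \<sigma> \<longleftrightarrow> (\<forall>\<epsilon>>0. \<exists>N. \<forall>m\<ge>N. \<forall>n\<ge>N. d (\<sigma> m) (\<sigma> n) < \<epsilon>)"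
proof -
  have "0 \<le> d (\<sigma> m) (\<sigma> n)" for m n
    using assms by (intro semimetricD(1)) auto
  then show ?thesis
    unfolding sm_Cauchy_def tendsto_iff eventually_prod_sequentially
    by (simp add: dist_real_def) meson
qed

section \<open>Comparison functions\<close>

lemma funpow_nonneg:
  fixes \<phi> :: "real \<Rightarrow> real"
  assumes "\<phi> \<in> {0..} \<rightarrow> {0..}" "0 \<le> t"
  shows "0 \<le> (\<phi> ^^ n) t"
  using assms by (induction n) auto

lemma mono_on_funpow:
  fixes \<phi> :: "real \<Rightarrow> real"
  assumes "\<phi> \<in> {0..} \<rightarrow> {0..}" "mono_on {0..} \<phi>"
  shows "mono_on {0..} (\<phi> ^^ n)"
proof (rule mono_onI)
  fix s t :: real assume st: "s \<in> {0..}" "t \<in> {0..}" "s \<le> t"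
  then have nonneg: "(\<phi> ^^ n) s \<in> {0..}" "(\<phi> ^^ n) t \<in> {0..}" for n
    using funpow_nonneg[OF assms(1)] by auto
  show "(\<phi> ^^ n) s \<le> (\<phi> ^^ n) t"
  proof (induction n)
    case (Suc n)
    then show ?case
      using mono_onD[OF assms(2) nonneg] by simp
  qed (use st in simp)
qed

lemma comparison_function_less:
  assumes "comparison_function \<phi>" "t > 0"
  shows "\<phi> t < t"
proof (rule ccontr)
  assume "\<not> \<phi> t < t"
  have "t \<le> (\<phi> ^^ n) t" for n
  proof (induction n)
    case (Suc n)
    then have "\<phi> t \<le> \<phi> ((\<phi> ^^ n) t)"
      using assms unfolding comparison_function_def by (auto intro: mono_onD)
    then show ?case
      using \<open>\<not> \<phi> t < t\<close> by simp
  qed simp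
  moreover have "(\<lambda>n. (\<phi> ^^ n) t) \<longlonglongrightarrow> 0"
    using assms unfolding comparison_function_def by blast
  ultimately show False
    using assms(2) by (meson LIMSEQ_le_const linorder_not_le)
qed

lemma comparison_function_0:
  assumes "comparison_function \<phi>"
  shows "\<phi> 0 = 0"
proof -
  have "\<phi> 0 \<le> t" if "t > 0" for t
  proof -
    have "\<phi> 0 \<le> \<phi> t"
      using assms that unfolding comparison_function_def by (auto intro: mono_onD)
    then show ?thesis
      using comparison_function_less[OF assms that] by simp
  qed
  then have "\<phi> 0 \<le> 0"
    by (rule dense_ge)
  moreover have "\<phi> 0 \<ge> 0"
    using assms unfolding comparison_function_def by auto
  ultimately show ?thesis
    by simp
qed

lemma comparison_function_le:
  assumes "comparison_function \<phi>" "t \<ge> 0"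
  shows "\<phi> t \<le> t"
  using comparison_function_0[OF assms(1)] comparison_function_less[OF assms(1), of t] assms(2)
  by (cases "t = 0") auto

lemma comparison_function_funpow_tendsto:
  assumes "comparison_function \<phi>" "t \<ge> 0"
  shows "(\<lambda>n. (\<phi> ^^ n) t) \<longlonglongrightarrow> 0"
proof (cases "t = 0")
  case True
  have "(\<phi> ^^ n) 0 = 0" for n
    by (induction n) (auto simp: comparison_function_0[OF assms(1)])
  then show ?thesis
    using True by simp
next
  case False
  then show ?thesis
    using assms unfolding comparison_function_def by auto
qed

text \<open>The last hypothesis combines \<open>\<phi> l < l\<close> with right-continuity at \<open>l\<close>.\<close>

lemma comparison_functionI:
  assumes nonneg: "\<phi> \<in> {0..} \<rightarrow> {0..}" and mono: "mono_on {0..} \<phi>"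
    and right: "\<And>l. l > 0 \<Longrightarrow> eventually (\<lambda>s. \<phi> s < l) (at_right l)"
  shows "comparison_function \<phi>"
  unfolding comparison_function_def
proof (intro conjI allI impI)
  have le: "\<phi> t \<le> t" if "t \<ge> 0" for t
  proof (rule dense_ge)
    fix l assume "t < l"
    then obtain b where b: "l < b" "\<And>y. l < y \<Longrightarrow> y < b \<Longrightarrow> \<phi> y < l"
      using right[of l] \<open>t \<ge> 0\<close> unfolding eventually_at_right_field by auto
    then obtain y where "l < y" "y < b"
      using dense by blast
    then have "\<phi> t \<le> \<phi> y" "\<phi> y < l"
      using mono_onD[OF mono, of t y] \<open>t < l\<close> \<open>t \<ge> 0\<close> b by auto
    then show "\<phi> t \<le> l"
      by simp
  qed
  fix t :: real assume "t > 0"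
  let ?a = "\<lambda>n. (\<phi> ^^ n) t"
  have pos: "0 \<le> ?a n" for n
    using funpow_nonneg[OF nonneg] \<open>t > 0\<close> by simp
  then have dec: "decseq ?a"
    using le by (intro decseq_SucI) auto
  then obtain l where l: "?a \<longlonglongrightarrow> l" "\<And>n. l \<le> ?a n"
    using decseq_convergent[of ?a 0] pos by auto
  have "l = 0"
  proof (rule ccontr)
    assume "l \<noteq> 0"
    then have "l > 0"
      using LIMSEQ_le_const[OF l(1), of 0] pos by simp
    then obtain b where b: "l < b" "\<And>y. l < y \<Longrightarrow> y < b \<Longrightarrow> \<phi> y < l"
      using right[of l] unfolding eventually_at_right_field by auto
    then obtain y where y: "l < y" "y < b"
      using dense by blast
    then obtain n where "?a n < y"
      using order_tendstoD(2)[OF l(1), of y] unfolding eventually_sequentially by blast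
    then have "?a (Suc n) \<le> \<phi> y"
      using mono_onD[OF mono, of "?a n" y] pos[of n] y \<open>l > 0\<close> by simp
    then show False
      using b y l(2)[of "Suc n"] by fastforce
  qed
  then show "?a \<longlonglongrightarrow> 0"
    using l by simp
qed (use nonneg mono in auto)

lemma comparison_function_Max:
  assumes I: "finite I" "I \<noteq> {}"
    and \<phi>: "\<And>i. i \<in> I \<Longrightarrow> comparison_function (\<phi> i)" "\<And>i. i \<in> I \<Longrightarrow> right_continuous (\<phi> i)"
  shows "comparison_function (\<lambda>t. Max ((\<lambda>i. \<phi> i t) ` I))"
proof (rule comparison_functionI)
  have nonneg: "0 \<le> \<phi> i t" if "i \<in> I" "t \<ge> 0" for i t
    using \<phi>(1)[OF that(1)] that(2) unfolding comparison_function_def by auto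
  show "(\<lambda>t. Max ((\<lambda>i. \<phi> i t) ` I)) \<in> {0..} \<rightarrow> {0..}"
    using I nonneg by (auto simp: Max_ge_iff ex_in_conv)
  show "mono_on {0..} (\<lambda>t. Max ((\<lambda>i. \<phi> i t) ` I))"
  proof (rule mono_onI)
    fix s t :: real assume st: "s \<in> {0..}" "t \<in> {0..}" "s \<le> t"
    have "\<phi> i s \<le> Max ((\<lambda>i. \<phi> i t) ` I)" if "i \<in> I" for i
    proof -
      have "\<phi> i s \<le> \<phi> i t"
        using \<phi>(1)[OF that] st unfolding comparison_function_def by (auto intro: mono_onD)
      also have "\<dots> \<le> Max ((\<lambda>i. \<phi> i t) ` I)"
        using I that by simp
      finally show ?thesis .
    qed
    then show "Max ((\<lambda>i. \<phi> i s) ` I) \<le> Max ((\<lambda>i. \<phi> i t) ` I)"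
      using I by simp
  qed
  fix l :: real assume "l > 0"
  have "eventually (\<lambda>s. \<phi> i s < l) (at_right l)" if "i \<in> I" for i
  proof (rule order_tendstoD(2))
    show "(\<phi> i \<longlongrightarrow> \<phi> i l) (at_right l)"
      using \<phi>(2)[OF that] \<open>l > 0\<close> unfolding right_continuous_def by (simp add: continuous_within)
    show "\<phi> i l < l"
      using comparison_function_less[OF \<phi>(1)[OF that] \<open>l > 0\<close>] .
  qed
  then have "eventually (\<lambda>s. \<forall>i\<in>I. \<phi> i s < l) (at_right l)"
    using I(1) by (simp add: eventually_ball_finite)
  then show "eventually (\<lambda>s. Max ((\<lambda>i. \<phi> i s) ` I) < l) (at_right l)"
    using I by simp
qed

section \<open>The contraction principle\<close>

lemma phi_contraction_funpow:
  assumes "semimetric X d" "comparison_function \<phi>" "phi_contraction X d \<phi> f" "x \<in> X" "y \<in> X"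
  shows "(f ^^ n) x \<in> X" "d ((f ^^ n) x) ((f ^^ n) y) \<le> (\<phi> ^^ n) (d x y)"
proof -
  have mem: "(f ^^ n) z \<in> X" if "z \<in> X" for z n
    using assms(3) that unfolding phi_contraction_def by (induction n) auto
  then show "(f ^^ n) x \<in> X"
    using assms(4) by simp
  show "d ((f ^^ n) x) ((f ^^ n) y) \<le> (\<phi> ^^ n) (d x y)"
  proof (induction n)
    case (Suc n)
    have "d ((f ^^ Suc n) x) ((f ^^ Suc n) y) \<le> \<phi> (d ((f ^^ n) x) ((f ^^ n) y))"
      using assms(3-5) mem unfolding phi_contraction_def by simp
    also have "\<dots> \<le> \<phi> ((\<phi> ^^ n) (d x y))"
    proof -
      have "mono_on {0..} \<phi>" "0 \<le> d ((f ^^ n) x) ((f ^^ n) y)"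
        using assms mem unfolding comparison_function_def by (auto intro: semimetricD(1))
      then show ?thesis
        using Suc by (auto intro: mono_onD)
    qed
    finally show ?case
      by simp
  qed simp
qed

text \<open>Two Picard sequences of a contraction approach each other; with \<open>y = (f ^^ p) x\<close> this says
  that terms of a single sequence with fixed index difference do.\<close>

lemma phi_contraction_eventually_close:
  assumes "semimetric X d" "comparison_function \<phi>" "phi_contraction X d \<phi> f" "x \<in> X" "y \<in> X"
    and "\<epsilon> > 0"
  shows "eventually (\<lambda>n. d ((f ^^ n) x) ((f ^^ n) y) \<le> \<epsilon>) sequentially"
proof -
  have "(\<lambda>n. (\<phi> ^^ n) (d x y)) \<longlonglongrightarrow> 0"
    using assms by (intro comparison_function_funpow_tendsto semimetricD(1))
  then have "eventually (\<lambda>n. (\<phi> ^^ n) (d x y) < \<epsilon>) sequentially"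
    using \<open>\<epsilon> > 0\<close> by (rule order_tendstoD)
  then show ?thesis
    by eventually_elim (use phi_contraction_funpow(2)[OF assms(1-5)] in \<open>fastforce intro: order_trans\<close>)
qed

lemma Picard_sequence_Cauchy:
  assumes sm: "semimetric X d" and reg: "sm_regular X d" and cf: "comparison_function \<phi>"
    and contr: "phi_contraction X d \<phi> f" and x: "x \<in> X"
  shows "sm_Cauchy d (\<lambda>n. (f ^^ n) x)"
proof -
  let ?x = "\<lambda>n. (f ^^ n) x"
  have mem: "?x n \<in> X" for n
    using phi_contraction_funpow(1)[OF sm cf contr x x] .
  have close: "eventually (\<lambda>n. d (?x (p + n)) (?x n) \<le> \<epsilon>) sequentially" if "\<epsilon> > 0" for p \<epsilon>
  proof -
    have "?x (p + n) = (f ^^ n) (?x p)" for n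
      unfolding add.commute[of p n] by (simp add: funpow_add)
    then show ?thesis
      using phi_contraction_eventually_close[OF sm cf contr mem[of p] x that] by simp
  qed
  have "\<exists>N. \<forall>m\<ge>N. \<forall>n\<ge>N. d (?x m) (?x n) < \<epsilon>" if "\<epsilon> > 0" for \<epsilon>
  proof -
    \<comment> \<open>Regularity is applied three times: \<open>\<gamma>\<close> bounds the distances along indices that differ by
      multiples of \<open>p\<close>, as well as those within one block of length \<open>p\<close>, and \<open>\<beta>\<close> bounds the
      distances of all late iterates to a fixed one.\<close>
    from \<open>\<epsilon> > 0\<close> obtain \<beta> where \<beta>: "\<beta> > 0" and
      tri1: "\<And>u v w. u \<in> X \<Longrightarrow> v \<in> X \<Longrightarrow> w \<in> X \<Longrightarrow> d u w \<le> \<beta> \<Longrightarrow> d v w \<le> \<beta> \<Longrightarrow> d u v \<le> \<epsilon> / 2"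
      using sm_regularE[OF sm reg, of "\<epsilon> / 2"] by auto
    obtain \<gamma> where \<gamma>: "\<gamma> > 0" and
      tri2: "\<And>u v w. u \<in> X \<Longrightarrow> v \<in> X \<Longrightarrow> w \<in> X \<Longrightarrow> d u w \<le> \<gamma> \<Longrightarrow> d v w \<le> \<gamma> \<Longrightarrow> d u v \<le> \<beta>"
      using sm_regularE[OF sm reg \<beta>] by blast
    obtain \<delta> where \<delta>: "\<delta> > 0" and
      tri3: "\<And>u v w. u \<in> X \<Longrightarrow> v \<in> X \<Longrightarrow> w \<in> X \<Longrightarrow> d u w \<le> \<delta> \<Longrightarrow> d v w \<le> \<delta> \<Longrightarrow> d u v \<le> \<gamma>"
      using sm_regularE[OF sm reg \<gamma>] by blast
    \<comment> \<open>With this \<open>p\<close>, the map \<open>f ^^ p\<close> sends the closed \<open>\<gamma>\<close>-ball around \<open>u\<close> into the closed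
      \<open>\<delta>\<close>-ball around \<open>(f ^^ p) u\<close>.\<close>
    have "eventually (\<lambda>n. (\<phi> ^^ n) \<gamma> < \<delta>) sequentially"
      using comparison_function_funpow_tendsto[OF cf, of \<gamma>] \<gamma> \<delta> by (intro order_tendstoD) auto
    then obtain p where p0: "p > 0" and p: "(\<phi> ^^ p) \<gamma> < \<delta>"
      unfolding eventually_sequentially by (metis le_add1 le_add2 less_add_one less_le_trans zero_le)
    have "eventually (\<lambda>n. \<forall>r\<in>{..<p}. d (?x (r + n)) (?x n) \<le> \<gamma>) sequentially"
      using close[OF \<gamma>] by (simp add: eventually_ball_finite)
    then have "eventually (\<lambda>n. (\<forall>r\<in>{..<p}. d (?x (r + n)) (?x n) \<le> \<gamma>) \<and> d (?x (p + n)) (?x n) \<le> \<delta>)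
        sequentially"
      using close[OF \<delta>] by (rule eventually_conj)
    then obtain N where
      N1: "\<And>r n. n \<ge> N \<Longrightarrow> r < p \<Longrightarrow> d (?x (r + n)) (?x n) \<le> \<gamma>" and
      N2: "\<And>n. n \<ge> N \<Longrightarrow> d (?x (p + n)) (?x n) \<le> \<delta>"
      unfolding eventually_sequentially by (meson lessThan_iff)
    \<comment> \<open>The closed \<open>\<gamma>\<close>-ball around \<open>(f ^^ n) x\<close> is invariant under \<open>f ^^ p\<close>, as \<open>f ^^ p\<close> moves its
      centre by at most \<open>\<delta>\<close>.\<close>
    have block: "d (?x (j * p + n)) (?x n) \<le> \<gamma>" if "n \<ge> N" for j n
    proof (induction j)
      case 0
      then show ?case
        using \<gamma> sm mem by simp
    next
      case (Suc j)
      have "d (?x (p + (j * p + n))) (?x (p + n)) \<le> (\<phi> ^^ p) (d (?x (j * p + n)) (?x n))"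
        using phi_contraction_funpow(2)[OF sm cf contr mem[of "j * p + n"] mem[of n], of p]
        by (simp add: funpow_add)
      also have "\<dots> \<le> (\<phi> ^^ p) \<gamma>"
      proof -
        have "mono_on {0..} (\<phi> ^^ p)"
          using cf unfolding comparison_function_def by (blast intro: mono_on_funpow)
        from mono_onD[OF this, of "d (?x (j * p + n)) (?x n)" \<gamma>] show ?thesis
          using Suc semimetricD(1)[OF sm mem mem] \<gamma> by simp
      qed
      finally have "d (?x (p + (j * p + n))) (?x (p + n)) \<le> \<delta>"
        using p by simp
      moreover have "d (?x n) (?x (p + n)) \<le> \<delta>"
        using N2[OF that] semimetricD(3)[OF sm mem mem, of n "p + n"] by simp
      ultimately show ?case
        using tri3[OF mem mem mem] by (metis add.assoc mult_Suc)
    qed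
    have tail: "d (?x m) (?x N) \<le> \<beta>" if "m \<ge> N" for m
    proof -
      let ?r = "(m - N) mod p" and ?j = "(m - N) div p"
      have m: "m = ?j * p + (?r + N)"
        using that div_mult_mod_eq[of "m - N" p] by linarith
      have "d (?x m) (?x (?r + N)) \<le> \<gamma>"
        using block[of "?r + N" ?j] m by simp
      moreover have "d (?x N) (?x (?r + N)) \<le> \<gamma>"
        using N1[of N ?r] p0 semimetricD(3)[OF sm mem mem, of N "?r + N"] by simp
      ultimately show ?thesis
        using tri2[OF mem mem mem] by blast
    qed
    have "d (?x m) (?x n) < \<epsilon>" if "m \<ge> N" "n \<ge> N" for m n
      using tri1[OF mem mem mem tail[OF that(1)] tail[OF that(2)]] \<open>\<epsilon> > 0\<close> by simp
    then show ?thesis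
      by blast
  qed
  then show ?thesis
    using mem by (subst sm_Cauchy_iff[OF sm]) auto
qed

theorem regular_complete_fixed_point:
  assumes sm: "semimetric X d" and reg: "sm_regular X d" and compl: "sm_complete X d"
    and cf: "comparison_function \<phi>" and contr: "phi_contraction X d \<phi> f"
  obtains x where "x \<in> X" "f x = x"
proof -
  obtain x0 where x0: "x0 \<in> X"
    using sm unfolding semimetric_def by auto
  let ?x = "\<lambda>n. (f ^^ n) x0"
  have mem: "?x n \<in> X" for n
    using phi_contraction_funpow(1)[OF sm cf contr x0 x0] .
  then have "range ?x \<subseteq> X"
    by auto
  then have "sm_convergent X d ?x"
    using compl Picard_sequence_Cauchy[OF sm reg cf contr x0] unfolding sm_complete_def by simp
  then obtain x where x: "x \<in> X" and lim: "(\<lambda>n. d (?x n) x) \<longlonglongrightarrow> 0"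
    unfolding sm_convergent_def by auto
  have fx: "f x \<in> X"
    using contr x unfolding phi_contraction_def by auto
  have "d (f x) x \<le> \<epsilon>" if "\<epsilon> > 0" for \<epsilon>
  proof -
    obtain \<delta> where \<delta>: "\<delta> > 0" and
      tri: "\<And>u v w. u \<in> X \<Longrightarrow> v \<in> X \<Longrightarrow> w \<in> X \<Longrightarrow> d u w \<le> \<delta> \<Longrightarrow> d v w \<le> \<delta> \<Longrightarrow> d u v \<le> \<epsilon>"
      using sm_regularE[OF sm reg \<open>\<epsilon> > 0\<close>] by blast
    obtain n where n: "\<And>m. m \<ge> n \<Longrightarrow> d (?x m) x < \<delta>"
      using order_tendstoD(2)[OF lim \<delta>] unfolding eventually_sequentially by blast
    have "d (?x (Suc n)) (f x) \<le> \<phi> (d (?x n) x)"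
      using contr mem x unfolding phi_contraction_def by simp
    also have "\<dots> \<le> d (?x n) x"
      using comparison_function_le[OF cf] semimetricD(1)[OF sm mem x] by simp
    finally have "d (f x) (?x (Suc n)) \<le> \<delta>"
      using n[of n] semimetricD(3)[OF sm fx mem] by (metis le_refl less_imp_le order_trans)
    moreover have "d x (?x (Suc n)) \<le> \<delta>"
      using n[of "Suc n"] semimetricD(3)[OF sm x mem] by (metis lessI less_imp_le)
    ultimately show ?thesis
      using tri[OF fx x mem] by blast
  qed
  then have "d (f x) x \<le> 0"
    by (rule dense_ge)
  then have "f x = x"
    using semimetricD(1,2)[OF sm fx x] by linarith
  then show ?thesis
    using that x by blast
qed

section \<open>Finite powers of a semi-metric space\<close>

text \<open>The maximum distance on the power \<open>I \<rightarrow>\<^sub>E X\<close>, for a finite non-empty index set \<open>I\<close>.\<close>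

definition max_dist :: "'i set \<Rightarrow> ('a \<Rightarrow> 'a \<Rightarrow> real) \<Rightarrow> ('i \<Rightarrow> 'a) \<Rightarrow> ('i \<Rightarrow> 'a) \<Rightarrow> real" where
  "max_dist I d x y = Max ((\<lambda>i. d (x i) (y i)) ` I)"

lemma max_dist_le_iff:
  assumes "finite I" "I \<noteq> {}"
  shows "max_dist I d x y \<le> r \<longleftrightarrow> (\<forall>i\<in>I. d (x i) (y i) \<le> r)"
  using assms by (simp add: max_dist_def)

lemma max_dist_less_iff:
  assumes "finite I" "I \<noteq> {}"
  shows "max_dist I d x y < r \<longleftrightarrow> (\<forall>i\<in>I. d (x i) (y i) < r)"
  using assms by (simp add: max_dist_def)

lemma le_max_dist:
  assumes "finite I" "i \<in> I"
  shows "d (x i) (y i) \<le> max_dist I d x y"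
  using assms by (simp add: max_dist_def)

context
  fixes I :: "'i set" and X :: "'a set" and d :: "'a \<Rightarrow> 'a \<Rightarrow> real"
  assumes fin: "finite I" and ne: "I \<noteq> {}" and sm: "semimetric X d"
begin

lemma max_dist_nonneg:
  assumes "x \<in> I \<rightarrow>\<^sub>E X" "y \<in> I \<rightarrow>\<^sub>E X"
  shows "0 \<le> max_dist I d x y"
proof -
  obtain i where "i \<in> I"
    using ne by blast
  then have "0 \<le> d (x i) (y i)"
    using assms by (intro semimetricD(1)[OF sm]) auto
  then show ?thesis
    using le_max_dist[OF fin \<open>i \<in> I\<close>, of d x y] by simp
qed

lemma semimetric_max_dist: "semimetric (I \<rightarrow>\<^sub>E X) (max_dist I d)"
  unfolding semimetric_def
proof (intro conjI ballI)
  show "I \<rightarrow>\<^sub>E X \<noteq> {}"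
    using sm unfolding semimetric_def by (simp add: PiE_eq_empty_iff)
  fix x y assume xy: "x \<in> I \<rightarrow>\<^sub>E X" "y \<in> I \<rightarrow>\<^sub>E X"
  then have mem: "x i \<in> X" "y i \<in> X" if "i \<in> I" for i
    using that by auto
  show "0 \<le> max_dist I d x y"
    using max_dist_nonneg[OF xy] .
  show "max_dist I d x y = max_dist I d y x"
    unfolding max_dist_def using semimetricD(3)[OF sm mem] by (simp cong: image_cong_simp)
  have "max_dist I d x y = 0 \<longleftrightarrow> max_dist I d x y \<le> 0"
    using max_dist_nonneg[OF xy] by linarith
  also have "\<dots> \<longleftrightarrow> (\<forall>i\<in>I. x i = y i)"
    unfolding max_dist_le_iff[OF fin ne]
    using semimetricD(1,2)[OF sm mem] by (metis order_antisym order_refl)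
  also have "\<dots> \<longleftrightarrow> x = y"
    using xy by (metis PiE_ext)
  finally show "max_dist I d x y = 0 \<longleftrightarrow> x = y" .
qed

lemma sm_regular_max_dist:
  assumes "sm_regular X d"
  shows "sm_regular (I \<rightarrow>\<^sub>E X) (max_dist I d)"
  unfolding sm_regular_iff[OF semimetric_max_dist] max_dist_le_iff[OF fin ne]
proof (intro allI impI)
  fix \<epsilon> :: real assume "\<epsilon> > 0"
  then obtain \<delta> where "\<delta> > 0"
    "\<And>x y z. x \<in> X \<Longrightarrow> y \<in> X \<Longrightarrow> z \<in> X \<Longrightarrow> d x z \<le> \<delta> \<Longrightarrow> d y z \<le> \<delta> \<Longrightarrow> d x y \<le> \<epsilon>"
    using sm_regularE[OF sm assms] by blast
  then show "\<exists>\<delta>>0. \<forall>x\<in>I \<rightarrow>\<^sub>E X. \<forall>y\<in>I \<rightarrow>\<^sub>E X. \<forall>z\<in>I \<rightarrow>\<^sub>E X. (\<forall>i\<in>I. d (x i) (z i) \<le> \<delta>) \<longrightarrow>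
      (\<forall>i\<in>I. d (y i) (z i) \<le> \<delta>) \<longrightarrow> (\<forall>i\<in>I. d (x i) (y i) \<le> \<epsilon>)"
    by (intro exI[of _ \<delta>]) (auto dest!: PiE_mem)
qed

lemma sm_complete_max_dist:
  assumes "sm_complete X d"
  shows "sm_complete (I \<rightarrow>\<^sub>E X) (max_dist I d)"
  unfolding sm_complete_def
proof (intro allI impI, elim conjE)
  fix \<sigma> :: "nat \<Rightarrow> 'i \<Rightarrow> 'a"
  assume ran: "range \<sigma> \<subseteq> I \<rightarrow>\<^sub>E X" and Cauchy: "sm_Cauchy (max_dist I d) \<sigma>"
  have "\<exists>x\<in>X. (\<lambda>n. d (\<sigma> n i) x) \<longlonglongrightarrow> 0" if "i \<in> I" for i
  proof -
    have ran_i: "range (\<lambda>n. \<sigma> n i) \<subseteq> X"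
      using ran that by (auto simp: image_subset_iff)
    have "sm_Cauchy d (\<lambda>n. \<sigma> n i)"
      using Cauchy that
      unfolding sm_Cauchy_iff[OF semimetric_max_dist ran] sm_Cauchy_iff[OF sm ran_i]
        max_dist_less_iff[OF fin ne] by meson
    then show ?thesis
      using assms ran_i unfolding sm_complete_def sm_convergent_def by blast
  qed
  then obtain x where x: "\<And>i. i \<in> I \<Longrightarrow> x i \<in> X" "\<And>i. i \<in> I \<Longrightarrow> (\<lambda>n. d (\<sigma> n i) (x i)) \<longlonglongrightarrow> 0"
    by metis
  define y where "y = restrict x I"
  have y: "y \<in> I \<rightarrow>\<^sub>E X"
    unfolding y_def using x by simp
  have "(\<lambda>n. max_dist I d (\<sigma> n) y) \<longlonglongrightarrow> 0"
  proof (rule order_tendstoI)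
    fix a :: real assume "0 < a"
    have "eventually (\<lambda>n. d (\<sigma> n i) (y i) < a) sequentially" if "i \<in> I" for i
      using order_tendstoD(2)[OF x(2)[OF that] \<open>0 < a\<close>] that by (simp add: y_def)
    then show "eventually (\<lambda>n. max_dist I d (\<sigma> n) y < a) sequentially"
      unfolding max_dist_less_iff[OF fin ne] using fin by (simp add: eventually_ball_finite)
  next
    fix a :: real assume "a < 0"
    moreover have "0 \<le> max_dist I d (\<sigma> n) y" for n
      using ran y by (intro max_dist_nonneg) auto
    ultimately show "eventually (\<lambda>n. a < max_dist I d (\<sigma> n) y) sequentially"
      by (simp add: less_le_trans)
  qed
  then show "sm_convergent (I \<rightarrow>\<^sub>E X) (max_dist I d) \<sigma>"
    unfolding sm_convergent_def using y by blast
qed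

end

section \<open>Fixed points of systems of contractions\<close>

text \<open>The system is the fixed point equation of a single contraction on \<open>I \<rightarrow>\<^sub>E X\<close>.\<close>

theorem contraction_system_fixed_point:
  assumes fin: "finite I" and ne: "I \<noteq> {}"
    and sm: "semimetric X d" and reg: "sm_regular X d" and compl: "sm_complete X d"
    and s: "s \<in> I \<rightarrow> I"
    and \<phi>: "\<And>i. i \<in> I \<Longrightarrow> comparison_function (\<phi> i)" "\<And>i. i \<in> I \<Longrightarrow> right_continuous (\<phi> i)"
    and g: "\<And>i. i \<in> I \<Longrightarrow> phi_contraction X d (\<phi> i) (g i)"
  obtains x where "x \<in> I \<rightarrow>\<^sub>E X" "\<And>i. i \<in> I \<Longrightarrow> x i = g i (x (s i))"
proof -
  let ?P = "I \<rightarrow>\<^sub>E X"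
  define F where "F = (\<lambda>x. \<lambda>i\<in>I. g i (x (s i)))"
  define \<psi> where "\<psi> = (\<lambda>t. Max ((\<lambda>i. \<phi> i t) ` I))"
  have "phi_contraction ?P (max_dist I d) \<psi> F"
    unfolding phi_contraction_def
  proof (intro conjI ballI)
    show "F \<in> ?P \<rightarrow> ?P"
      using s g unfolding F_def phi_contraction_def by (auto simp: PiE_iff Pi_iff)
    fix x y assume xy: "x \<in> ?P" "y \<in> ?P"
    have "d (F x i) (F y i) \<le> \<psi> (max_dist I d x y)" if i: "i \<in> I" for i
    proof -
      have si: "s i \<in> I"
        using s i by auto
      then have mem: "x (s i) \<in> X" "y (s i) \<in> X"
        using xy by auto
      have "d (F x i) (F y i) \<le> \<phi> i (d (x (s i)) (y (s i)))"
        using g[OF i] i mem unfolding F_def phi_contraction_def by simp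
      also have "\<dots> \<le> \<phi> i (max_dist I d x y)"
      proof -
        have "mono_on {0..} (\<phi> i)"
          using \<phi>(1)[OF i] unfolding comparison_function_def by blast
        from mono_onD[OF this, of "d (x (s i)) (y (s i))" "max_dist I d x y"] show ?thesis
          using semimetricD(1)[OF sm mem] max_dist_nonneg[OF fin ne sm xy]
            le_max_dist[OF fin si, of d x y]
          by simp
      qed
      also have "\<dots> \<le> \<psi> (max_dist I d x y)"
        unfolding \<psi>_def using fin i by simp
      finally show ?thesis .
    qed
    then show "max_dist I d (F x) (F y) \<le> \<psi> (max_dist I d x y)"
      by (simp add: max_dist_le_iff[OF fin ne])
  qed
  moreover have "comparison_function \<psi>"
    unfolding \<psi>_def using fin ne \<phi> by (rule comparison_function_Max)
  ultimately obtain x where x: "x \<in> ?P" "F x = x"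
    using regular_complete_fixed_point[OF semimetric_max_dist[OF fin ne sm]
        sm_regular_max_dist[OF fin ne sm reg] sm_complete_max_dist[OF fin ne sm compl]] by blast
  have "x i = g i (x (s i))" if "i \<in> I" for i
    using fun_cong[OF x(2), of i] that by (simp add: F_def)
  then show ?thesis
    using that x(1) by blast
qed

lemma singleton_mem_nonempty_bounded_subsets:
  assumes "semimetric X d" "x \<in> X"
  shows "{x} \<in> nonempty_bounded_subsets X d"
proof -
  have "{x} \<subseteq> sm_ball X d x 1"
    using assms by (simp add: sm_ball_def)
  then show ?thesis
    using assms(2) zero_less_one unfolding nonempty_bounded_subsets_def sm_bounded_def by blast
qed

theorem lemma3p1:
  fixes X :: "'a set" and d :: "'a \<Rightarrow> 'a \<Rightarrow> real"
    and q :: nat and E :: "nat \<Rightarrow> nat \<Rightarrow> 'e set"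
    and \<phi> :: "'e \<Rightarrow> real \<Rightarrow> real" and f :: "'e \<Rightarrow> 'a \<Rightarrow> 'a"
  assumes "semimetric X d"
    and "sm_normal X d" and "sm_regular X d" and "sm_complete X d"
    and "q \<ge> 1"
    and "\<And>i j. i \<in> {1..q} \<Longrightarrow> j \<in> {1..q} \<Longrightarrow> finite (E i j)"
    and "\<And>i. i \<in> {1..q} \<Longrightarrow> \<exists>j\<in>{1..q}. E i j \<noteq> {}"
    and "\<And>i j e. i \<in> {1..q} \<Longrightarrow> j \<in> {1..q} \<Longrightarrow> e \<in> E i j \<Longrightarrow>
           comparison_function (\<phi> e) \<and> right_continuous (\<phi> e) \<and> phi_contraction X d (\<phi> e) (f e)"
  shows "\<exists>H0 \<in> {1..q} \<rightarrow>\<^sub>E nonempty_bounded_subsets X d.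
           (\<forall>i\<in>{1..q}. H0 i \<noteq> {}) \<and>
           (\<forall>i\<in>{1..q}. H0 i \<subseteq> graph_operator q E f H0 i)"
proof -
  let ?V = "{1..q}"
  have "\<exists>j e. j \<in> ?V \<and> e \<in> E i j" if "i \<in> ?V" for i
    using assms(7)[OF that] by blast
  then obtain s e where s: "\<And>i. i \<in> ?V \<Longrightarrow> s i \<in> ?V" and e: "\<And>i. i \<in> ?V \<Longrightarrow> e i \<in> E i (s i)"
    by metis
  have edge: "comparison_function (\<phi> (e i))" "right_continuous (\<phi> (e i))"
    "phi_contraction X d (\<phi> (e i)) (f (e i))" if "i \<in> ?V" for i
    using assms(8)[OF that s[OF that] e[OF that]] by auto
  have "?V \<noteq> {}"
    using \<open>q \<ge> 1\<close> by simp
  then obtain x where x: "x \<in> ?V \<rightarrow>\<^sub>E X" and x_eq: "\<And>i. i \<in> ?V \<Longrightarrow> x i = f (e i) (x (s i))"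
    using contraction_system_fixed_point[of ?V X d s "\<lambda>i. \<phi> (e i)" "\<lambda>i. f (e i)"]
      assms(1,3,4) s edge by (metis Pi_I finite_atLeastAtMost)
  define H where "H = (\<lambda>i\<in>?V. {x i})"
  have "H \<in> ?V \<rightarrow>\<^sub>E nonempty_bounded_subsets X d"
    unfolding H_def using x
    by (auto intro!: singleton_mem_nonempty_bounded_subsets[OF assms(1)])
  moreover have "H i \<subseteq> graph_operator q E f H i" if i: "i \<in> ?V" for i
  proof -
    have "x i \<in> f (e i) ` H (s i)"
      using x_eq[OF i] s[OF i] by (simp add: H_def)
    then have "x i \<in> graph_operator q E f H i"
      unfolding graph_operator_def using i s[OF i] e[OF i] by (simp del: atLeastAtMost_iff) blast
    then show ?thesis
      using i by (simp add: H_def)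
  qed
  ultimately show ?thesis
    by (intro bexI[of _ H]) (auto simp: H_def)
qed

end
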